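(* Consider the system $$\dot x=f(x,z,w),\quad z=(z_1,\dots,z_N),\quad z_i=h_i(x,w),\quad y_i=z_i+a_i,\qquad i\in\mathbb{N}_{[1,N]},$$ with $f$ and all $h_i$ locally Lipschitz, of whose $N$ outputs at most $M$ are compromised, i.e. the attack vector $a=(a_1,\dots,a_N)$ belongs to $\mathcal{N}_{\mathcal{I}}$ for some set $\mathcal{I}\subset\mathbb{N}_{[1,N]}$ with $\#(\mathcal{I})\le M$. Assume that $N>2M$ and that, for every set $\mathcal{J}\subset\mathbb{N}_{[1,N]}$ with $\#(\mathcal{J})\ge N-2M$, there exists a function $\hat f:\mathbb{R}^{n_x}\times\mathbb{R}^{n_{\mathcal{J}}}\times\mathbb{R}^{n_u}\to\mathbb{R}^{n_x}$, where $n_{\mathcal{J}}:=\sum_{i\in\mathcal{J}}n_i$, such that the solution to $\dot{\hat x}_{\mathcal{J}}=\hat f(\hat x_{\mathcal{J}},y_{\mathcal{J}},w)$ and the solution to the system satisfy $$|x(t)-\hat x_{\mathcal{J}}(t)|\le\hat\beta\left(|x(0)-\hat x_{\mathcal{J}}(0)|,t\right)+\hat\gamma\left(\sup_{s\in[0,t)}|a_{\mathcal{J}}(s)|\right)$$ for all $t\ge0$ and all initial conditions $x(0),\hat x_{\mathcal{J}}(0)\in\mathbb{R}^{n_x}$, where $\hat\beta$ is a class $\mathcal{KL}$ function and $\hat\gamma$ is a class $\mathcal{K}_\infty$ function. Then there exists a class $\mathcal{KL}$ function $\tilde\beta$ such that the solution $x$ to the system and the estimate $\hat x$ produced by the secure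 state estimation algorithm (defined in the context) satisfy $$|x(t)-\hat x(t)|\le\tilde\beta\left(|x(0)-\hat x(0)|,t\right),\qquad\forall t\ge0,$$ for any initial conditions $x(0),\hat x_{\mathcal{S}}(0),\hat x_{\mathcal{P}}(0)\in\mathbb{R}^{n_x}$.
   Context: Setting. $x\in\mathbb{R}^{n_x}$ is the state, $y_i\in\mathbb{R}^{n_i}$ is the measured output of sensor $i$, $w\in\mathbb{R}^{n_u}$ is a measured input signal, and $a_i\in\mathbb{R}^{n_i}$ is an unmeasured, possibly unbounded attack signal (a function of time $t\ge0$). $\mathbb{N}_{[1,N]}=\{1,\dots,N\}$; $\#(\cdot)$ denotes cardinality; $\subset$ denotes not necessarily proper inclusion. For an index set $\mathcal{J}$, $y_{\mathcal{J}}$ and $a_{\mathcal{J}}$ are the stacked vectors of the $y_i$ and $a_i$, $i\in\mathcal{J}$. $|\cdot|$ is the infinity norm. Attack signals. Sensors that are not under attack satisfy $a_i(t)=0$ for all $t\ge0$, and the set of non-attacked sensors is constant in time. For $\mathcal{I}\subset\mathbb{N}_{[1,N]}$, $\mathcal{N}_{\mathcal{I}}:=\{(a_1,\dots,a_N): a_i(t)=0\ \forall t\ge0,\ \forall i\notin\mathcal{I}\}$. Comparison functions. A class $\mathcal{K}$ function is a continuous, strictly increasing $\alpha:[0,\infty)\to[0,\infty)$ with $\alpha(0)=0$; it is class $\mathcal{K}_\infty$ if additionally $\alpha(r)\to\infty$ as $r\to\infty$. A class $\mathcal{KL}$ function is a continuous $\beta:[0,\infty)\times[0,\infty)\to[0,\infty)$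 such that $\beta(\cdot,s)$ is class $\mathcal{K}$ for each $s\ge0$, $\beta(r,\cdot)$ is non-increasing, and $\beta(r,s)\to0$ as $s\to\infty$ for each $r\ge0$. Secure state estimation algorithm. For every $\mathcal{S}\subset\mathbb{N}_{[1,N]}$ with $\#(\mathcal{S})=N-M$, run the observer $\dot{\hat x}_{\mathcal{S}}=\hat f(\hat x_{\mathcal{S}},y_{\mathcal{S}},w)$, and for every $\mathcal{P}\subset\mathbb{N}_{[1,N]}$ with $\#(\mathcal{P})=N-2M$, run the observer $\dot{\hat x}_{\mathcal{P}}=\hat f(\hat x_{\mathcal{P}},y_{\mathcal{P}},w)$, where in each case $\hat f$ is the function provided by the assumption for the corresponding index set (it may depend on that set). For each $\mathcal{S}$ with $\#(\mathcal{S})=N-M$ define the consistency measure $$\pi_{\mathcal{S}}(t)=\max_{\mathcal{P}\subset\mathcal{S}:\,\#(\mathcal{P})=N-2M}\left|\hat x_{\mathcal{S}}(t)-\hat x_{\mathcal{P}}(t)\right|.$$ The state estimate produced by the algorithm is $$\hat x(t)=\hat x_{\sigma(t)}(t),\qquad\sigma(t)=\underset{\mathcal{S}\subset\mathbb{N}_{[1,N]}:\,\#(\mathcal{S})=N-M}{\arg\min}\ \pi_{\mathcal{S}}(t).$$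
   Formalization: The initial error |x(0)-x̂(0)| in the bound is replaced by the maximum of |x(0)-x̂_S(0)| and |x(0)-x̂_P(0)| over all observers, since the literal bound fails for independent initial conditions; the two agree when all observers start at the same point. *)

theory Defs
  imports "HOL-Analysis.Analysis"
begin

text \<open>
  Sensors are the numbers \<open>1, \<dots>, N\<close>. Since the dimension \<open>n\<^sub>i\<close> of the output of
  sensor \<open>i\<close> depends on \<open>i\<close>, all outputs live in the total output space \<open>real ^ 'p\<close>, whose
  coordinate \<open>k\<close> belongs to sensor \<open>own k\<close>. The space of sensor \<open>i\<close> is the coordinate
  subspace below, with \<open>n\<^sub>i = card {k. own k = i}\<close>. Stacking a family of such vectors is
  then the same as adding them up, and \<open>infnorm\<close> of the sum is the infinity norm of the
  stacked vector.
\<close>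

definition output_space :: "('p \<Rightarrow> nat) \<Rightarrow> nat \<Rightarrow> (real ^ 'p) set" where
  "output_space own i = {v. \<forall>k. own k \<noteq> i \<longrightarrow> v $ k = 0}"

definition stack :: "nat set \<Rightarrow> (nat \<Rightarrow> real \<Rightarrow> real ^ 'p) \<Rightarrow> real \<Rightarrow> real ^ 'p" where
  "stack J v t = (\<Sum>i\<in>J. v i t)"

definition locally_lipschitz :: "('a::metric_space \<Rightarrow> 'b::metric_space) \<Rightarrow> bool" where
  "locally_lipschitz g \<longleftrightarrow> (\<forall>x. \<exists>u>0. \<exists>L. L-lipschitz_on (cball x u) g)"


definition class_K :: "(real \<Rightarrow> real) \<Rightarrow> bool" where
  "class_K \<alpha> \<longleftrightarrow> continuous_on {0..} \<alpha> \<and> strict_mono_on {0..} \<alpha> \<and> \<alpha> 0 = 0"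

definition class_Kinf :: "(real \<Rightarrow> real) \<Rightarrow> bool" where
  "class_Kinf \<alpha> \<longleftrightarrow> class_K \<alpha> \<and> filterlim \<alpha> at_top at_top"

definition class_KL :: "(real \<Rightarrow> real \<Rightarrow> real) \<Rightarrow> bool" where
  "class_KL \<beta> \<longleftrightarrow>
     continuous_on ({0..} \<times> {0..}) (\<lambda>(r, s). \<beta> r s) \<and>
     (\<forall>s\<ge>0. class_K (\<lambda>r. \<beta> r s)) \<and>
     (\<forall>r\<ge>0. antimono_on {0..} (\<beta> r) \<and> (\<beta> r \<longlongrightarrow> 0) at_top)"


text \<open>
  Attack vectors of \<open>\<N>\<^sub>I\<close>; times \<open>t < 0\<close> are irrelevant.
\<close>

definition attacks :: "('p \<Rightarrow> nat) \<Rightarrow> nat \<Rightarrow> nat set \<Rightarrow> (nat \<Rightarrow> real \<Rightarrow> real ^ 'p) set" where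
  "attacks own N I =
     {a. (\<forall>i\<in>{1..N}. \<forall>t\<ge>0. a i t \<in> output_space own i) \<and>
         (\<forall>i\<in>{1..N} - I. \<forall>t\<ge>0. a i t = 0)}"

text \<open>
  Supremum of the norm of the stacked attack over \<open>[0, t)\<close>. It can be infinite, and it is \<open>0\<close> for
  \<open>t = 0\<close>, the supremum of the empty set in \<open>[0, \<infinity>]\<close>.
\<close>

definition attack_sup :: "nat set \<Rightarrow> (nat \<Rightarrow> real \<Rightarrow> real ^ 'p) \<Rightarrow> real \<Rightarrow> ennreal" where
  "attack_sup J a t = (SUP s\<in>{0..<t}. ennreal (infnorm (stack J a s)))"


text \<open>
  Solutions on \<open>[0, \<infinity>)\<close> of \<open>x' = F t x\<close> in the sense of Caratheodory, because attacks and inputs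
  need not be continuous.
\<close>

definition ode_solution ::
    "(real \<Rightarrow> 'a::euclidean_space \<Rightarrow> 'a) \<Rightarrow> (real \<Rightarrow> 'a) \<Rightarrow> bool" where
  "ode_solution F x \<longleftrightarrow>
     (\<forall>t\<ge>0. (\<lambda>s. F s (x s)) absolutely_integrable_on {0..t} \<and>
            x t = x 0 + integral {0..t} (\<lambda>s. F s (x s)))"

definition plant_solution ::
    "nat \<Rightarrow> ((real ^ 'n) \<times> (real ^ 'p) \<times> (real ^ 'u) \<Rightarrow> real ^ 'n) \<Rightarrow>
     (nat \<Rightarrow> (real ^ 'n) \<times> (real ^ 'u) \<Rightarrow> real ^ 'p) \<Rightarrow>
     (real \<Rightarrow> real ^ 'u) \<Rightarrow> (real \<Rightarrow> real ^ 'n) \<Rightarrow> bool" where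
  "plant_solution N f h w x \<longleftrightarrow>
     ode_solution (\<lambda>t \<xi>. f (\<xi>, \<Sum>i\<in>{1..N}. h i (\<xi>, w t), w t)) x"

definition measurement ::
    "(nat \<Rightarrow> (real ^ 'n) \<times> (real ^ 'u) \<Rightarrow> real ^ 'p) \<Rightarrow> (nat \<Rightarrow> real \<Rightarrow> real ^ 'p) \<Rightarrow>
     (real \<Rightarrow> real ^ 'u) \<Rightarrow> (real \<Rightarrow> real ^ 'n) \<Rightarrow> nat \<Rightarrow> real \<Rightarrow> real ^ 'p" where
  "measurement h a w x i t = h i (x t, w t) + a i t"

definition observer_solution ::
    "((real ^ 'n) \<times> (real ^ 'p) \<times> (real ^ 'u) \<Rightarrow> real ^ 'n) \<Rightarrow> (real \<Rightarrow> real ^ 'p) \<Rightarrow>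
     (real \<Rightarrow> real ^ 'u) \<Rightarrow> (real \<Rightarrow> real ^ 'n) \<Rightarrow> bool" where
  "observer_solution g yJ w xh \<longleftrightarrow> ode_solution (\<lambda>t \<xi>. g (\<xi>, yJ t, w t)) xh"

text \<open>
  The estimate required of an observer. Where the supremum of the attack is infinite, so is its image
  under a function of class \<open>\<K>\<^sub>\<infinity>\<close>, and the estimate is void.
\<close>

definition observer_estimate ::
    "(real \<Rightarrow> real \<Rightarrow> real) \<Rightarrow> (real \<Rightarrow> real) \<Rightarrow> nat set \<Rightarrow> (nat \<Rightarrow> real \<Rightarrow> real ^ 'p) \<Rightarrow>
     (real \<Rightarrow> real ^ 'n) \<Rightarrow> (real \<Rightarrow> real ^ 'n) \<Rightarrow> bool" where
  "observer_estimate \<beta> \<gamma> J a x xh \<longleftrightarrow>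
     (\<forall>t\<ge>0. attack_sup J a t < \<infinity> \<longrightarrow>
        infnorm (x t - xh t) \<le> \<beta> (infnorm (x 0 - xh 0)) t + \<gamma> (enn2real (attack_sup J a t)))"


definition index_sets :: "nat \<Rightarrow> nat \<Rightarrow> nat set set" where
  "index_sets N m = {J. J \<subseteq> {1..N} \<and> card J = m}"

text \<open>
  \<open>xS\<close> and \<open>xP\<close> are the families of observer states for the sets of size \<open>N - M\<close> and \<open>N - 2M\<close>.
  They are separate families, so that for \<open>M = 0\<close>, where the sizes agree, the two observers of the
  set \<open>{1..N}\<close> may start at different points.
\<close>

definition consistency ::
    "nat \<Rightarrow> nat \<Rightarrow> (nat set \<Rightarrow> real \<Rightarrow> real ^ 'n) \<Rightarrow> (nat set \<Rightarrow> real \<Rightarrow> real ^ 'n) \<Rightarrow>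
     nat set \<Rightarrow> real \<Rightarrow> real" where
  "consistency N M xS xP S t =
     Max ((\<lambda>P. infnorm (xS S t - xP P t)) ` {P \<in> index_sets N (N - 2 * M). P \<subseteq> S})"

text \<open>The minimizer need not be unique; any selection from the minimizers is admitted.\<close>

definition selection ::
    "nat \<Rightarrow> nat \<Rightarrow> (nat set \<Rightarrow> real \<Rightarrow> real ^ 'n) \<Rightarrow> (nat set \<Rightarrow> real \<Rightarrow> real ^ 'n) \<Rightarrow>
     (real \<Rightarrow> nat set) \<Rightarrow> bool" where
  "selection N M xS xP \<sigma> \<longleftrightarrow>
     (\<forall>t\<ge>0. is_arg_min (\<lambda>S. consistency N M xS xP S t) (\<lambda>S. S \<in> index_sets N (N - M)) (\<sigma> t))"

definition estimate ::
    "(nat set \<Rightarrow> real \<Rightarrow> real ^ 'n) \<Rightarrow> (real \<Rightarrow> nat set) \<Rightarrow> real \<Rightarrow> real ^ 'n" where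
  "estimate xS \<sigma> t = xS (\<sigma> t) t"

text \<open>
  The initial estimation error is the infinity norm of the stacked initial errors of all observers of
  the algorithm. If all of them start at the same point, this is the distance of \<open>x 0\<close> to the
  initial estimate (lemma \<open>initial_error_common\<close>). For observers with different initial states, the
  error of the one selected at time \<open>0\<close> alone cannot bound later errors: an observer fed by an
  attacked sensor can start exactly at \<open>x 0\<close>, be selected at time \<open>0\<close>, and be abandoned afterwards
  in favour of observers that started away from \<open>x 0\<close>.
\<close>

definition initial_error ::
    "nat \<Rightarrow> nat \<Rightarrow> (real \<Rightarrow> real ^ 'n) \<Rightarrow> (nat set \<Rightarrow> real \<Rightarrow> real ^ 'n) \<Rightarrow>
     (nat set \<Rightarrow> real \<Rightarrow> real ^ 'n) \<Rightarrow> real" where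
  "initial_error N M x xS xP =
     Max ((\<lambda>S. infnorm (x 0 - xS S 0)) ` index_sets N (N - M) \<union>
          (\<lambda>P. infnorm (x 0 - xP P 0)) ` index_sets N (N - 2 * M))"

lemma initial_error_common:
  assumes S: "\<forall>S\<in>index_sets N (N - M). xS S 0 = c"
    and P: "\<forall>P\<in>index_sets N (N - 2 * M). xP P 0 = c"
    and sel: "selection N M xS xP \<sigma>"
  shows "initial_error N M x xS xP = infnorm (x 0 - estimate xS \<sigma> 0)"
proof -
  have \<sigma>: "\<sigma> 0 \<in> index_sets N (N - M)"
    using sel by (auto simp: selection_def is_arg_min_def)
  then have "(\<lambda>S. infnorm (x 0 - xS S 0)) ` index_sets N (N - M) \<union>
      (\<lambda>P. infnorm (x 0 - xP P 0)) ` index_sets N (N - 2 * M) = {infnorm (x 0 - c)}"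
    using S P by auto
  then show ?thesis
    using S \<sigma> by (simp add: initial_error_def estimate_def)
qed

end

theory Submission
  imports Defs
begin

text \<open>
  Call an index set clean if it contains no attacked sensor. The observer of a clean set sees a zero
  attack, so its error is bounded by a class \<open>\<K>\<L>\<close> function of its own initial error
  (\<open>observer_error_without_attack\<close>). There are only finitely many index sets. Since class
  \<open>\<K>\<L>\<close> functions are nonnegative and increase with their first argument, the sum of them all,
  again of class \<open>\<K>\<L>\<close> (\<open>class_KL_sum\<close>) and evaluated at the joint initial error, gives one
  bound \<open>b\<close> on the errors of all clean observers.

  The rest is a pigeonhole argument at one instant (\<open>consistent_estimate_error\<close>). At most \<open>M\<close> sensors
  are attacked, so some set of size \<open>N - M\<close> is clean, and so are all its subsets; by the
  triangle inequality through the true state its consistency measure is at most \<open>2 b\<close>. The minimizer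
  \<open>S\<close> therefore has measure at most \<open>2 b\<close> as well, even if it is attacked itself. But \<open>S\<close> contains
  at least \<open>N - 2 M\<close> clean sensors, so the maximum defining its measure ranges over a clean subset
  \<open>P\<close>. The observer of \<open>P\<close> is within \<open>b\<close> of the true state and within \<open>2 b\<close> of the observer of
  \<open>S\<close>, which yields the bound \<open>3 b\<close>. Each instant is treated separately, so the selected set may switch arbitrarily.
\<close>

lemma class_K_nonneg:
  assumes "class_K \<alpha>" and "0 \<le> r"
  shows "0 \<le> \<alpha> r"
proof (cases "r = 0")
  case False
  then have "\<alpha> 0 < \<alpha> r"
    using assms strict_mono_onD[of "{0..}" \<alpha> 0 r] by (simp add: class_K_def)
  then show ?thesis
    using assms by (simp add: class_K_def)
qed (use assms in \<open>simp add: class_K_def\<close>)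

lemma class_K_mono:
  assumes "class_K \<alpha>" and "0 \<le> r" and "r \<le> r'"
  shows "\<alpha> r \<le> \<alpha> r'"
proof (cases "r = r'")
  case False
  then have "\<alpha> r < \<alpha> r'"
    using assms strict_mono_onD[of "{0..}" \<alpha> r r'] by (simp add: class_K_def)
  then show ?thesis by simp
qed simp

lemma class_KL_nonneg:
  assumes "class_KL \<beta>" and "0 \<le> r" and "0 \<le> s"
  shows "0 \<le> \<beta> r s"
  using assms class_K_nonneg[of "\<lambda>r. \<beta> r s" r] by (simp add: class_KL_def)

lemma class_KL_mono:
  assumes "class_KL \<beta>" and "0 \<le> r" and "r \<le> r'" and "0 \<le> s"
  shows "\<beta> r s \<le> \<beta> r' s"
  using assms class_K_mono[of "\<lambda>r. \<beta> r s" r r'] by (simp add: class_KL_def)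

text \<open>
  The index set has to be nonempty: the empty sum is \<open>0\<close>, which is not strictly increasing in the
  first argument.
\<close>

lemma class_KL_sum:
  assumes fin: "finite F" and ne: "F \<noteq> {}" and KL: "\<And>j. j \<in> F \<Longrightarrow> class_KL (\<beta> j)"
  shows "class_KL (\<lambda>r s. \<Sum>j\<in>F. \<beta> j r s)"
  unfolding class_KL_def class_K_def
proof (intro conjI allI impI)
  have "continuous_on ({0..} \<times> {0..}) (\<lambda>p. \<Sum>j\<in>F. (\<lambda>(r, s). \<beta> j r s) p)"
    using KL by (intro continuous_on_sum) (simp add: class_KL_def)
  then show "continuous_on ({0..} \<times> {0..}) (\<lambda>(r, s). \<Sum>j\<in>F. \<beta> j r s)"
    by (simp add: case_prod_unfold)
next
  fix s :: real assume s: "0 \<le> s"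
  have K: "class_K (\<lambda>r. \<beta> j r s)" if "j \<in> F" for j
    using KL[OF that] s by (simp add: class_KL_def)
  show "continuous_on {0..} (\<lambda>r. \<Sum>j\<in>F. \<beta> j r s)"
    using K by (intro continuous_on_sum) (simp add: class_K_def)
  show "strict_mono_on {0..} (\<lambda>r. \<Sum>j\<in>F. \<beta> j r s)"
    using K by (intro strict_mono_onI sum_strict_mono fin ne)
      (auto simp: class_K_def strict_mono_on_def)
  show "(\<Sum>j\<in>F. \<beta> j 0 s) = 0"
    using K by (intro sum.neutral) (simp add: class_K_def)
next
  fix r :: real assume r: "0 \<le> r"
  have L: "antimono_on {0..} (\<beta> j r)" "(\<beta> j r \<longlongrightarrow> 0) at_top" if "j \<in> F" for j
    using KL[OF that] r by (simp_all add: class_KL_def)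
  show "antimono_on {0..} (\<lambda>s. \<Sum>j\<in>F. \<beta> j r s)"
    using L(1) by (intro monotone_onI sum_mono) (auto simp: monotone_on_def)
  show "((\<lambda>s. \<Sum>j\<in>F. \<beta> j r s) \<longlongrightarrow> 0) at_top"
    using L(2) by (intro tendsto_null_sum)
qed

lemma class_KL_scale:
  assumes "class_KL \<beta>" and "0 < c"
  shows "class_KL (\<lambda>r s. c * \<beta> r s)"
  unfolding class_KL_def class_K_def
proof (intro conjI allI impI)
  have "continuous_on ({0..} \<times> {0..}) (\<lambda>p. c * (\<lambda>(r, s). \<beta> r s) p)"
    using assms by (intro continuous_on_mult_left) (simp add: class_KL_def)
  then show "continuous_on ({0..} \<times> {0..}) (\<lambda>(r, s). c * \<beta> r s)"
    by (simp add: case_prod_unfold)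
next
  fix s :: real assume s: "0 \<le> s"
  have K: "class_K (\<lambda>r. \<beta> r s)"
    using assms s by (simp add: class_KL_def)
  show "continuous_on {0..} (\<lambda>r. c * \<beta> r s)"
    using K by (intro continuous_on_mult_left) (simp add: class_K_def)
  show "strict_mono_on {0..} (\<lambda>r. c * \<beta> r s)"
    using K \<open>0 < c\<close> by (auto simp: class_K_def strict_mono_on_def)
  show "c * \<beta> 0 s = 0"
    using K by (simp add: class_K_def)
next
  fix r :: real assume r: "0 \<le> r"
  have L: "antimono_on {0..} (\<beta> r)" "(\<beta> r \<longlongrightarrow> 0) at_top"
    using assms r by (simp_all add: class_KL_def)
  show "antimono_on {0..} (\<lambda>s. c * \<beta> r s)"
    using L(1) \<open>0 < c\<close> by (auto simp: monotone_on_def)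
  show "((\<lambda>s. c * \<beta> r s) \<longlongrightarrow> 0) at_top"
    using L(2) by (rule tendsto_mult_right_zero)
qed

lemma finite_index_sets: "finite (index_sets N m)"
  by (rule finite_subset[of _ "Pow {1..N}"]) (auto simp: index_sets_def)

lemma attack_sup_clean:
  assumes "a \<in> attacks own N I" and "J \<subseteq> {1..N} - I"
  shows "attack_sup J a t = 0"
proof -
  have "stack J a s = 0" if "0 \<le> s" for s
    using assms that by (auto simp: stack_def attacks_def intro!: sum.neutral)
  then have "attack_sup J a t = (SUP s\<in>{0..<t}. 0)"
    by (auto simp: attack_sup_def infnorm_0 intro!: SUP_cong)
  \<comment> \<open>A supremum of zeros is \<open>0\<close>, and over the empty interval it is the least element, again \<open>0\<close>.\<close>
  then show ?thesis
    by (cases "{0..<t} = {}") (auto simp: bot_ennreal)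
qed

lemma observer_error_without_attack:
  assumes "observer_estimate \<beta> \<gamma> J a x xh" and "class_Kinf \<gamma>"
    and "a \<in> attacks own N I" and "J \<subseteq> {1..N} - I" and "0 \<le> t"
  shows "infnorm (x t - xh t) \<le> \<beta> (infnorm (x 0 - xh 0)) t"
proof -
  have "\<gamma> 0 = 0"
    using assms(2) by (simp add: class_Kinf_def class_K_def)
  then show ?thesis
    using assms(1,5) attack_sup_clean[OF assms(3,4)] by (simp add: observer_estimate_def)
qed

text \<open>
  The counting step of the pigeonhole argument, used twice: with the set of all \<open>N\<close> sensors and
  \<open>m = N - M\<close>, and with a selected set of \<open>N - M\<close> sensors and \<open>m = N - 2 M\<close>.
\<close>

lemma obtain_clean_subset:
  assumes "finite I" and "m + card I \<le> card S"
  obtains P where "P \<subseteq> S - I" and "card P = m"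
proof -
  have "m \<le> card (S - I)"
    using diff_card_le_card_Diff[OF assms(1), of S] assms(2) by simp
  then show ?thesis
    using that obtain_subset_with_card_n by metis
qed

text \<open>
  The algorithm at a single instant \<open>t\<close>, where only the distances of the observer states from a point
  \<open>z\<close> matter. The clean set \<open>S0\<close> shows that the minimal consistency measure is at most \<open>2 b\<close>; the
  clean subset \<open>P\<close> of the minimizer turns this into a bound on the distance from \<open>z\<close>.
\<close>

lemma consistent_estimate_error:
  assumes I: "I \<subseteq> {1..N}" "card I \<le> M" and NM: "2 * M < N"
    and min: "is_arg_min (\<lambda>S. consistency N M xS xP S t) (\<lambda>S. S \<in> index_sets N (N - M)) S"
    and clean_S: "\<And>S. S \<in> index_sets N (N - M) \<Longrightarrow> S \<inter> I = {} \<Longrightarrow> infnorm (z - xS S t) \<le> b"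
    and clean_P: "\<And>P. P \<in> index_sets N (N - 2 * M) \<Longrightarrow> P \<inter> I = {} \<Longrightarrow> infnorm (z - xP P t) \<le> b"
  shows "infnorm (z - xS S t) \<le> 3 * b"
proof -
  define \<P> where "\<P> S = {P \<in> index_sets N (N - 2 * M). P \<subseteq> S}" for S
  have finI: "finite I"
    using I(1) finite_subset by blast
  have fin: "finite (\<P> S)" for S
    using finite_index_sets by (simp add: \<P>_def)
  have tri: "infnorm (u - v) \<le> infnorm (z - u) + infnorm (z - v)" for u v
    using infnorm_triangle[of "u - z" "z - v"] by (simp add: infnorm_sub)
  have S: "S \<subseteq> {1..N}" "card S = N - M"
    using min by (auto simp: is_arg_min_def index_sets_def)
  obtain S0 where S0: "S0 \<subseteq> {1..N} - I" "card S0 = N - M"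
  proof (rule obtain_clean_subset[OF finI])
    show "N - M + card I \<le> card {1..N}"
      using I(2) NM by simp
  qed
  then have S0_mem: "S0 \<in> index_sets N (N - M)" and S0_clean: "S0 \<inter> I = {}"
    by (auto simp: index_sets_def)
  have "\<P> S0 \<noteq> {}"
  proof -
    obtain P where "P \<subseteq> S0" "card P = N - 2 * M"
      using obtain_subset_with_card_n[of "N - 2 * M" S0] S0(2) by force
    then show ?thesis
      using S0(1) by (auto simp: \<P>_def index_sets_def)
  qed
  moreover have "infnorm (xS S0 t - xP P t) \<le> 2 * b" if "P \<in> \<P> S0" for P
    using tri[of "xS S0 t" "xP P t"] clean_S[OF S0_mem S0_clean] clean_P[of P] that S0_clean
    by (fastforce simp: \<P>_def)
  ultimately have "consistency N M xS xP S0 t \<le> 2 * b"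
    using fin by (simp add: consistency_def \<P>_def[symmetric])
  then have consistent: "consistency N M xS xP S t \<le> 2 * b"
    using min S0_mem by (fastforce simp: is_arg_min_def)
  obtain P where P: "P \<subseteq> S - I" "card P = N - 2 * M"
  proof (rule obtain_clean_subset[OF finI])
    show "N - 2 * M + card I \<le> card S"
      using I(2) NM S(2) by simp
  qed
  then have P_mem: "P \<in> \<P> S" and P_clean: "P \<in> index_sets N (N - 2 * M)" "P \<inter> I = {}"
    using S(1) by (auto simp: \<P>_def index_sets_def)
  have "infnorm (xS S t - xP P t) \<le> consistency N M xS xP S t"
    unfolding consistency_def \<P>_def[symmetric] using P_mem fin by (intro Max_ge) auto
  then have "infnorm (xP P t - xS S t) \<le> 2 * b"
    using consistent by (simp add: infnorm_sub)
  moreover have "infnorm (z - xP P t) \<le> b"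
    using clean_P P_clean by blast
  ultimately show ?thesis
    using infnorm_triangle[of "z - xP P t" "xP P t - xS S t"] by simp
qed

theorem theorem2:
  fixes N M :: nat
    and own :: "'p::finite \<Rightarrow> nat"
    and f :: "(real ^ 'n) \<times> (real ^ 'p) \<times> (real ^ 'u) \<Rightarrow> real ^ 'n"
    and h :: "nat \<Rightarrow> (real ^ 'n) \<times> (real ^ 'u) \<Rightarrow> real ^ 'p"
    and fhat :: "nat set \<Rightarrow> (real ^ 'n) \<times> (real ^ 'p) \<times> (real ^ 'u) \<Rightarrow> real ^ 'n"
    and W :: "(real \<Rightarrow> real ^ 'u) set"
    and A :: "(nat \<Rightarrow> real \<Rightarrow> real ^ 'p) set"
  assumes "range own \<subseteq> {1..N}"
    and "locally_lipschitz f"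
    and "\<forall>i\<in>{1..N}. locally_lipschitz (h i) \<and> range (h i) \<subseteq> output_space own i"
    and "\<forall>a\<in>A. \<exists>I. I \<subseteq> {1..N} \<and> card I \<le> M \<and> a \<in> attacks own N I"
    and "N > 2 * M"
    and "\<forall>J. J \<subseteq> {1..N} \<and> card J \<ge> N - 2 * M \<longrightarrow>
           (\<exists>\<beta> \<gamma>. class_KL \<beta> \<and> class_Kinf \<gamma> \<and>
              (\<forall>w\<in>W. \<forall>a\<in>A. \<forall>x xh.
                 plant_solution N f h w x \<and>
                 observer_solution (fhat J) (stack J (measurement h a w x)) w xh \<longrightarrow>
                 observer_estimate \<beta> \<gamma> J a x xh))"
  shows "\<exists>\<beta>. class_KL \<beta> \<and>
           (\<forall>w\<in>W. \<forall>a\<in>A. \<forall>x xS xP \<sigma>.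
              plant_solution N f h w x \<and>
              (\<forall>S\<in>index_sets N (N - M).
                 observer_solution (fhat S) (stack S (measurement h a w x)) w (xS S)) \<and>
              (\<forall>P\<in>index_sets N (N - 2 * M).
                 observer_solution (fhat P) (stack P (measurement h a w x)) w (xP P)) \<and>
              selection N M xS xP \<sigma> \<longrightarrow>
              (\<forall>t\<ge>0. infnorm (x t - estimate xS \<sigma> t) \<le> \<beta> (initial_error N M x xS xP) t))"
proof -
  define \<J> where "\<J> = {J. J \<subseteq> {1..N} \<and> card J \<ge> N - 2 * M}"
  have fin: "finite \<J>"
    by (rule finite_subset[of _ "Pow {1..N}"]) (auto simp: \<J>_def)
  have "{1..N} \<in> \<J>"
    by (simp add: \<J>_def)
  then have ne: "\<J> \<noteq> {}"
    by blast
  have sub: "index_sets N (N - M) \<subseteq> \<J>" "index_sets N (N - 2 * M) \<subseteq> \<J>"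
    by (auto simp: index_sets_def \<J>_def)
  have "\<forall>J\<in>\<J>. \<exists>\<beta> \<gamma>. class_KL \<beta> \<and> class_Kinf \<gamma> \<and>
              (\<forall>w\<in>W. \<forall>a\<in>A. \<forall>x xh.
                 plant_solution N f h w x \<and>
                 observer_solution (fhat J) (stack J (measurement h a w x)) w xh \<longrightarrow>
                 observer_estimate \<beta> \<gamma> J a x xh)"
    using assms(6) by (simp add: \<J>_def)
  then obtain \<beta> \<gamma> where KL: "\<And>J. J \<in> \<J> \<Longrightarrow> class_KL (\<beta> J)"
    and Kinf: "\<And>J. J \<in> \<J> \<Longrightarrow> class_Kinf (\<gamma> J)"
    and est: "\<And>J w a x xh. J \<in> \<J> \<Longrightarrow> w \<in> W \<Longrightarrow> a \<in> A \<Longrightarrow> plant_solution N f h w x \<Longrightarrow>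
        observer_solution (fhat J) (stack J (measurement h a w x)) w xh \<Longrightarrow>
        observer_estimate (\<beta> J) (\<gamma> J) J a x xh"
    by (subst (asm) bchoice_iff) (metis (no_types, lifting) someI_ex)
  define B where "B r s = (\<Sum>J\<in>\<J>. \<beta> J r s)" for r s
  have "class_KL (\<lambda>r s. 3 * B r s)"
    unfolding B_def using class_KL_scale class_KL_sum[OF fin ne KL] by simp
  moreover have "infnorm (x t - estimate xS \<sigma> t) \<le> 3 * B (initial_error N M x xS xP) t"
    if w: "w \<in> W" and a: "a \<in> A" and plant: "plant_solution N f h w x"
      and obsS: "\<forall>S\<in>index_sets N (N - M).
                 observer_solution (fhat S) (stack S (measurement h a w x)) w (xS S)"
      and obsP: "\<forall>P\<in>index_sets N (N - 2 * M).
                 observer_solution (fhat P) (stack P (measurement h a w x)) w (xP P)"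
      and sel: "selection N M xS xP \<sigma>" and t: "0 \<le> t"
    for w a x xS xP \<sigma> t
  proof -
    let ?E = "initial_error N M x xS xP"
    obtain I where I: "I \<subseteq> {1..N}" "card I \<le> M" "a \<in> attacks own N I"
      using assms(4) a by blast
    have clean: "infnorm (x t - xh t) \<le> B ?E t"
      if J: "J \<in> \<J>" "J \<inter> I = {}"
        and obs: "observer_solution (fhat J) (stack J (measurement h a w x)) w xh"
        and init: "infnorm (x 0 - xh 0) \<le> ?E"
      for J xh
    proof -
      have E: "0 \<le> ?E"
        using init infnorm_pos_le[of "x 0 - xh 0"] by linarith
      have "J \<subseteq> {1..N} - I"
        using J by (auto simp: \<J>_def)
      then have "infnorm (x t - xh t) \<le> \<beta> J (infnorm (x 0 - xh 0)) t"
        using observer_error_without_attack est[OF J(1) w a plant obs] Kinf[OF J(1)] I(3) t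
        by blast
      also have "\<dots> \<le> \<beta> J ?E t"
        using class_KL_mono[OF KL[OF J(1)] infnorm_pos_le init t] .
      also have "\<dots> \<le> B ?E t"
        unfolding B_def using J(1) fin class_KL_nonneg[OF KL E t] by (intro member_le_sum) auto
      finally show ?thesis .
    qed
    have initS: "infnorm (x 0 - xS S 0) \<le> ?E" if "S \<in> index_sets N (N - M)" for S
      unfolding initial_error_def using that by (intro Max_ge) (auto simp: finite_index_sets)
    have initP: "infnorm (x 0 - xP P 0) \<le> ?E" if "P \<in> index_sets N (N - 2 * M)" for P
      unfolding initial_error_def using that by (intro Max_ge) (auto simp: finite_index_sets)
    show ?thesis
      unfolding estimate_def
    proof (rule consistent_estimate_error[OF I(1,2) assms(5)])
      show "is_arg_min (\<lambda>S. consistency N M xS xP S t) (\<lambda>S. S \<in> index_sets N (N - M)) (\<sigma> t)"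
        using sel t by (simp add: selection_def)
      show "infnorm (x t - xS S t) \<le> B ?E t" if "S \<in> index_sets N (N - M)" "S \<inter> I = {}" for S
        using clean[of S "xS S"] that sub(1) obsS initS by blast
      show "infnorm (x t - xP P t) \<le> B ?E t" if "P \<in> index_sets N (N - 2 * M)" "P \<inter> I = {}" for P
        using clean[of P "xP P"] that sub(2) obsP initP by blast
    qed
  qed
  ultimately show ?thesis
    by blast
qed

end
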